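(* Let $M\colon\bigcup_{n=1}^{\infty}\mathbb{R}_+^n\to\mathbb{R}_+$ be an increasing, symmetric, repetition invariant, and Jensen concave mean. Then its Hardy constant satisfies $$\mathscr{H}_\infty(M)=\sup_{y>0}\ \liminf_{n\to\infty}\ \frac{n}{y}\cdot M\Big(\frac{y}{1},\frac{y}{2},\ldots,\frac{y}{n}\Big),$$ as an equality in the extended real numbers.
   Context: $\mathbb{R}_+$ denotes the set of positive real numbers. A mean on $\mathbb{R}_+$ is a function $M\colon\bigcup_{n=1}^\infty\mathbb{R}_+^n\to\mathbb{R}_+$ with $\min(x_1,\dots,x_n)\le M(x_1,\dots,x_n)\le\max(x_1,\dots,x_n)$ for all $n\in\mathbb{N}$ and $(x_1,\dots,x_n)\in\mathbb{R}_+^n$. $M$ is symmetric, increasing (i.e. nondecreasing in each variable), or Jensen concave if, for every $n$, its restriction to $\mathbb{R}_+^n$ is, respectively, invariant under permutations of the variables, nondecreasing in each variable, or satisfies $M\big(\frac{x+y}{2}\big)\ge\frac{M(x)+M(y)}{2}$ for all $x,y\in\mathbb{R}_+^n$. $M$ is repetition invariant if for all $n,m\in\mathbb{N}$ and $(x_1,\dots,x_n)\in\mathbb{R}_+^n$, $M(x_1,\dots,x_1,\dots,x_n,\dots,x_n)=M(x_1,\dots,x_n)$, where on the left each $x_i$ is repeated $m$ times. The Hardy constant $\mathscr{H}_\infty(M)\in[0,\infty]$ is the smallest nonnegative extended real number $C$ such that $\sum_{n=1}^\infty M(x_1,\dots,x_n)\le C\sum_{n=1}^\infty x_n$ for all sequences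 $(x_n)$ of positive numbers with $\sum x_n<\infty$. *)

theory Defs
  imports "HOL-Analysis.Analysis" "HOL-Library.Multiset"
begin

(* The union of all R_+^n with n >= 1 is encoded as the set of nonempty lists of positive reals.
   A function on it is a HOL function on all real lists; its values elsewhere are never used. *)
definition pos_tuples :: "real list set" where
  "pos_tuples = {xs. xs \<noteq> [] \<and> (\<forall>x\<in>set xs. 0 < x)}"

definition is_mean :: "(real list \<Rightarrow> real) \<Rightarrow> bool" where
  "is_mean M \<longleftrightarrow> (\<forall>xs\<in>pos_tuples. Min (set xs) \<le> M xs \<and> M xs \<le> Max (set xs))"

definition symmetric_mean :: "(real list \<Rightarrow> real) \<Rightarrow> bool" where
  "symmetric_mean M \<longleftrightarrow> (\<forall>xs\<in>pos_tuples. \<forall>ys. mset ys = mset xs \<longrightarrow> M ys = M xs)"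

definition increasing_mean :: "(real list \<Rightarrow> real) \<Rightarrow> bool" where
  "increasing_mean M \<longleftrightarrow>
     (\<forall>xs\<in>pos_tuples. \<forall>i<length xs. \<forall>t. xs ! i \<le> t \<longrightarrow> M xs \<le> M (xs[i := t]))"

definition jensen_concave_mean :: "(real list \<Rightarrow> real) \<Rightarrow> bool" where
  "jensen_concave_mean M \<longleftrightarrow>
     (\<forall>xs\<in>pos_tuples. \<forall>ys\<in>pos_tuples. length xs = length ys \<longrightarrow>
        (M xs + M ys) / 2 \<le> M (map2 (\<lambda>a b. (a + b) / 2) xs ys))"

definition repetition_invariant :: "(real list \<Rightarrow> real) \<Rightarrow> bool" where
  "repetition_invariant M \<longleftrightarrow>
     (\<forall>xs\<in>pos_tuples. \<forall>m\<ge>1. M (concat (map (replicate m) xs)) = M xs)"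

(* The entry x n of a sequence stands for the (n+1)-st term, so that map x [0..<Suc n] is
   the tuple of its first n+1 terms. *)
definition hardy_bound :: "(real list \<Rightarrow> real) \<Rightarrow> ereal \<Rightarrow> bool" where
  "hardy_bound M C \<longleftrightarrow> 0 \<le> C \<and>
     (\<forall>x :: nat \<Rightarrow> real. (\<forall>n. 0 < x n) \<and> summable x \<longrightarrow>
        (\<Sum>n. ereal (M (map x [0..<Suc n]))) \<le> C * ereal (\<Sum>n. x n))"

definition hardy_constant :: "(real list \<Rightarrow> real) \<Rightarrow> ereal" where
  "hardy_constant M = Inf {C. hardy_bound M C}"

(* The infimum is attained, i.e. it is the smallest admissible C. *)
lemma hardy_constant_least:
  shows "hardy_bound M (hardy_constant M)"
    and "hardy_bound M C \<Longrightarrow> hardy_constant M \<le> C"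
proof -
  show "hardy_bound M C \<Longrightarrow> hardy_constant M \<le> C"
    unfolding hardy_constant_def by (simp add: Inf_lower)
  have "(\<Sum>n. ereal (M (map x [0..<Suc n]))) \<le> hardy_constant M * ereal (\<Sum>n. x n)"
    if x: "\<forall>n. 0 < x n" "summable x" for x :: "nat \<Rightarrow> real"
  proof -
    have S: "0 < (\<Sum>n. x n)" using x by (simp add: suminf_pos)
    have "(\<Sum>n. ereal (M (map x [0..<Suc n]))) / ereal (\<Sum>n. x n) \<le> C"
      if "hardy_bound M C" for C
    proof -
      have "(\<Sum>n. ereal (M (map x [0..<Suc n]))) \<le> C * ereal (\<Sum>n. x n)"
        using that x unfolding hardy_bound_def by blast
      with S show ?thesis by (subst ereal_divide_le_pos) (auto simp: mult.commute)
    qed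
    then have "(\<Sum>n. ereal (M (map x [0..<Suc n]))) / ereal (\<Sum>n. x n) \<le> hardy_constant M"
      unfolding hardy_constant_def by (intro Inf_greatest) auto
    with S show ?thesis by (subst (asm) ereal_divide_le_pos) (auto simp: mult.commute)
  qed
  moreover have "0 \<le> hardy_constant M"
    unfolding hardy_constant_def by (intro Inf_greatest) (auto simp: hardy_bound_def)
  ultimately show "hardy_bound M (hardy_constant M)"
    unfolding hardy_bound_def by blast
qed

end

theory Submission
  imports Defs
begin

text \<open>The upper bound rests on Kedlaya's inequality: the average of the means of the initial
  segments of \<open>x\<close> is at most the mean of the averages of these segments. If \<open>y\<close> is the sum of \<open>x\<close>,
  the \<open>k\<close>-th average is at most \<open>y / k\<close>, and monotonicity gives the right-hand side. Kedlaya's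
  inequality follows by induction on the length, using Jensen concavity for averages of permuted
  tuples. The lower bound tests the Hardy inequality on truncations of \<open>y / k\<close>.\<close>

section \<open>Positivity and monotonicity on whole tuples\<close>

lemma pos_tuples_map_iff: "map v [0..<n] \<in> pos_tuples \<longleftrightarrow> 0 < n \<and> (\<forall>i<n. 0 < v i)"
  by (auto simp: pos_tuples_def)

lemma is_mean_pos:
  assumes "is_mean M" "xs \<in> pos_tuples"
  shows "0 < M xs"
proof -
  have "0 < Min (set xs)"
    using assms(2) by (auto simp: pos_tuples_def)
  with assms show ?thesis
    unfolding is_mean_def by force
qed

text \<open>The definition raises one entry at a time, so \<open>v\<close> is turned into
  \<open>w\<close> position by position; \<open>?u k\<close> agrees with \<open>w\<close> in the
  first \<open>k\<close> places.\<close>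

lemma increasing_mean_mono:
  fixes v w :: "nat \<Rightarrow> real"
  assumes "increasing_mean M" "0 < n"
    and pos: "\<And>i. i < n \<Longrightarrow> 0 < v i" and le: "\<And>i. i < n \<Longrightarrow> v i \<le> w i"
  shows "M (map v [0..<n]) \<le> M (map w [0..<n])"
proof -
  let ?u = "\<lambda>k i. if i < k then w i else v i"
  have "M (map v [0..<n]) \<le> M (map (?u k) [0..<n])" if "k \<le> n" for k
    using that
  proof (induction k)
    case 0
    then show ?case by simp
  next
    case (Suc k)
    have "map (?u k) [0..<n] \<in> pos_tuples"
      unfolding pos_tuples_map_iff using assms(2) pos le by (auto intro: less_le_trans)
    moreover have "map (?u k) [0..<n] ! k \<le> w k"
      using Suc.prems le by simp
    ultimately have "M (map (?u k) [0..<n]) \<le> M ((map (?u k) [0..<n])[k := w k])"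
      using assms(1) Suc.prems unfolding increasing_mean_def by simp
    also have "(map (?u k) [0..<n])[k := w k] = map (?u (Suc k)) [0..<n]"
      using Suc.prems by (intro nth_equalityI) (auto simp: nth_list_update)
    finally show ?case using Suc by simp
  qed
  from this[of n] have "M (map v [0..<n]) \<le> M (map (?u n) [0..<n])" by simp
  also have "map (?u n) [0..<n] = map w [0..<n]" by simp
  finally show ?thesis .
qed

section \<open>Jensen's inequality for averages of finitely many tuples\<close>

text \<open>Doubling: the midpoint inequality is applied to the averages \<open>?a\<close> and
  \<open>?b\<close> of the two halves of the family.\<close>

lemma jensen_concave_mean_power2:
  fixes v :: "nat \<Rightarrow> nat \<Rightarrow> real"
  assumes "jensen_concave_mean M" "0 < n"
    and "\<And>i j. i < 2 ^ r \<Longrightarrow> j < n \<Longrightarrow> 0 < v i j"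
  shows "(\<Sum>i<2^r. M (map (v i) [0..<n])) / 2 ^ r \<le> M (map (\<lambda>j. (\<Sum>i<2^r. v i j) / 2 ^ r) [0..<n])"
  using assms(3)
proof (induction r arbitrary: v)
  case 0
  then show ?case by (simp add: lessThan_Suc)
next
  case (Suc r)
  have split: "(\<Sum>i<2 ^ Suc r. f i) = (\<Sum>i<2^r. f i) + (\<Sum>i<2^r. f (2 ^ r + i))" for f :: "nat \<Rightarrow> real"
  proof -
    have "{..<2 ^ Suc r} = {..<2 ^ r} \<union> {2^r..<2^r + (2::nat)^r}" by auto
    then have "(\<Sum>i<2 ^ Suc r. f i) = (\<Sum>i<2^r. f i) + (\<Sum>i=2^r..<2^r + 2^r. f i)"
      by (metis (no_types, lifting) finite_atLeastLessThan finite_lessThan ivl_disj_int_one(2)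
          sum.union_disjoint)
    also have "(\<Sum>i=2^r..<2^r + 2^r. f i) = (\<Sum>i<2^r. f (2 ^ r + i))"
      using sum.shift_bounds_nat_ivl[of f 0 "2^r" "2^r"] by (simp add: atLeast0LessThan add.commute)
    finally show ?thesis .
  qed
  let ?a = "\<lambda>j. (\<Sum>i<2^r. v i j) / 2 ^ r" and ?b = "\<lambda>j. (\<Sum>i<2^r. v (2 ^ r + i) j) / 2 ^ r"
  have a: "(\<Sum>i<2^r. M (map (v i) [0..<n])) / 2 ^ r \<le> M (map ?a [0..<n])"
    using Suc.prems by (intro Suc.IH) auto
  have b: "(\<Sum>i<2^r. M (map (v (2 ^ r + i)) [0..<n])) / 2 ^ r \<le> M (map ?b [0..<n])"
    using Suc.prems by (intro Suc.IH) auto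
  have "map ?a [0..<n] \<in> pos_tuples" "map ?b [0..<n] \<in> pos_tuples"
    unfolding pos_tuples_map_iff using assms(2) Suc.prems
    by (auto intro!: divide_pos_pos sum_pos simp: lessThan_empty_iff)
  then have "(M (map ?a [0..<n]) + M (map ?b [0..<n])) / 2
      \<le> M (map2 (\<lambda>a b. (a + b) / 2) (map ?a [0..<n]) (map ?b [0..<n]))"
    using assms(1) unfolding jensen_concave_mean_def by simp
  also have "map2 (\<lambda>a b. (a + b) / 2) (map ?a [0..<n]) (map ?b [0..<n])
      = map (\<lambda>j. (\<Sum>i<2^Suc r. v i j) / 2 ^ Suc r) [0..<n]"
    unfolding split by (intro nth_equalityI) (auto simp: add_divide_distrib)
  finally show ?case
    using a b unfolding split by (simp add: add_divide_distrib)
qed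

text \<open>Adding copies of the average to the family leaves the average unchanged, and their means
  cancel against the right-hand side of the power-of-two case, which leaves the factor
  \<open>m\<close>.\<close>

lemma jensen_concave_mean_average:
  fixes v :: "nat \<Rightarrow> nat \<Rightarrow> real"
  assumes "jensen_concave_mean M" "0 < n" "0 < m"
    and pos: "\<And>i j. i < m \<Longrightarrow> j < n \<Longrightarrow> 0 < v i j"
  shows "(\<Sum>i<m. M (map (v i) [0..<n])) \<le> real m * M (map (\<lambda>j. (\<Sum>i<m. v i j) / real m) [0..<n])"
proof -
  let ?a = "\<lambda>j. (\<Sum>i<m. v i j) / real m"
  let ?w = "\<lambda>i. if i < m then v i else ?a"
  have m: "m < 2 ^ m" by (rule less_exp)
  have split: "(\<Sum>i<2^m. if i < m then f i else c) = (\<Sum>i<m. f i) + (2 ^ m - real m) * c"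
    for f :: "nat \<Rightarrow> real" and c
  proof -
    have "(\<Sum>i<2^m. if i < m then f i else c)
        = (\<Sum>i<m. if i < m then f i else c) + (\<Sum>i=m..<2^m. if i < m then f i else c)"
      using m sum.atLeastLessThan_concat[of 0 m "2^m" "\<lambda>i. if i < m then f i else c", symmetric]
      by (simp only: atLeast0LessThan less_imp_le)
    also have "\<dots> = (\<Sum>i<m. f i) + (2 ^ m - real m) * c"
      using m by (simp add: of_nat_diff)
    finally show ?thesis .
  qed
  have apos: "0 < ?a j" if "j < n" for j
    using that assms(3) pos by (intro divide_pos_pos sum_pos) (auto simp: lessThan_empty_iff)
  \<comment> \<open>pad with copies of the average up to a power of two\<close>
  have "(\<Sum>i<2^m. M (map (?w i) [0..<n])) / 2 ^ m \<le> M (map (\<lambda>j. (\<Sum>i<2^m. ?w i j) / 2 ^ m) [0..<n])"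
    using pos apos by (intro jensen_concave_mean_power2 assms) auto
  also have "(\<lambda>j. (\<Sum>i<2^m. ?w i j) / 2 ^ m) = ?a"
  proof
    fix j
    have "(\<Sum>i<2^m. ?w i j) = (\<Sum>i<2^m. if i < m then v i j else ?a j)"
      by (intro sum.cong) auto
    also have "\<dots> = 2 ^ m * ?a j"
      unfolding split using assms(3) by (simp add: field_simps)
    finally show "(\<Sum>i<2^m. ?w i j) / 2 ^ m = ?a j" by simp
  qed
  also have "(\<Sum>i<2^m. M (map (?w i) [0..<n]))
      = (\<Sum>i<2^m. if i < m then M (map (v i) [0..<n]) else M (map ?a [0..<n]))"
    by (intro sum.cong) auto
  finally show ?thesis
    unfolding split by (simp add: field_simps)
qed

section \<open>Block tuples, their multisets and rotations\<close>

lemma concat_map_replicate_upt: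
  assumes "0 < m"
  shows "concat (map (replicate m) (map f [0..<n])) = map (\<lambda>p. f (p div m)) [0..<n * m]"
proof (induction n)
  case 0
  then show ?case by simp
next
  case (Suc n)
  have "[0..<Suc n * m] = [0..<n * m] @ [n * m..<n * m + m]"
    using upt_add_eq_append[of 0 "n * m" m] by (simp add: add.commute)
  moreover have "map (\<lambda>p. f (p div m)) [n * m..<n * m + m] = replicate m (f n)"
    using assms by (intro nth_equalityI) (auto simp: div_add1_eq)
  ultimately show ?case using Suc by simp
qed

lemma repetition_invariant_div:
  assumes "repetition_invariant M" "0 < m" "0 < n" "\<And>i. i < n \<Longrightarrow> 0 < v i"
  shows "M (map (\<lambda>p. v (p div m)) [0..<n * m]) = M (map v [0..<n])"
proof -
  have "map v [0..<n] \<in> pos_tuples"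
    unfolding pos_tuples_map_iff using assms by auto
  moreover have "1 \<le> m"
    using assms(2) by simp
  ultimately have "M (concat (map (replicate m) (map v [0..<n]))) = M (map v [0..<n])"
    using assms(1) unfolding repetition_invariant_def by blast
  then show ?thesis
    unfolding concat_map_replicate_upt[OF assms(2)] .
qed

text \<open>Each position is split into block and offset, so that two tuples can be recognised as
  permutations of each other by counting block by block.\<close>

lemma mset_map_upt_blocks:
  fixes f :: "nat \<Rightarrow> 'a"
  shows "mset (map f [0..<a * b]) = (\<Sum>j<a. \<Sum>s<b. {#f (j * b + s)#})"
proof -
  have "mset (map f [0..<n]) = (\<Sum>p<n. {#f p#})" for n
    by (induction n) auto
  also have "(\<Sum>p<a * b. {#f p#}) = (\<Sum>j<a. \<Sum>s=j * b..<j * b + b. {#f s#})"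
    by (rule sum.nat_group[symmetric])
  also have "\<dots> = (\<Sum>j<a. \<Sum>s<b. {#f (j * b + s)#})"
  proof (rule sum.cong[OF refl])
    fix j
    show "(\<Sum>s=j * b..<j * b + b. {#f s#}) = (\<Sum>s<b. {#f (j * b + s)#})"
      using sum.shift_bounds_nat_ivl[of "\<lambda>s. {#f s#}" 0 "j * b" b]
      by (simp add: atLeast0LessThan add.commute)
  qed
  finally show ?thesis .
qed

text \<open>A shift modulo \<open>n\<close> permutes the residues. The general monoid serves both
  sums of reals and unions of multisets.\<close>

lemma sum_rotate:
  fixes f :: "nat \<Rightarrow> 'a::comm_monoid_add"
  assumes "0 < n"
  shows "(\<Sum>s<n. f ((s + t) mod n)) = (\<Sum>s<n. f s)"
proof -
  have "inj_on (\<lambda>s. (s + t) mod n) {..<n}"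
  proof (rule inj_onI)
    fix x y assume xy: "x \<in> {..<n}" "y \<in> {..<n}" "(x + t) mod n = (y + t) mod n"
    then obtain q r where "(x + t) + n * q = (y + t) + n * r"
      unfolding nat_mod_eq_iff by auto
    then have "x + n * q = y + n * r" by simp
    then have "x mod n = y mod n"
      unfolding nat_mod_eq_iff by blast
    with xy show "x = y" by simp
  qed
  moreover have "(\<lambda>s. (s + t) mod n) ` {..<n} \<subseteq> {..<n}"
    using assms by auto
  ultimately have "bij_betw (\<lambda>s. (s + t) mod n) {..<n} {..<n}"
    by (simp add: bij_betw_def endo_inj_surj)
  then show ?thesis
    by (rule sum.reindex_bij_betw)
qed

lemma sum_mset_singleton_const: "(\<Sum>s\<in>A. {#c#}) = replicate_mset (card A) c"
  by (induction A rule: infinite_finite_induct) auto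

section \<open>Interpolated tuples and Kedlaya's inequality\<close>

lemma interpolation_pos:
  fixes a :: "nat \<Rightarrow> real"
  assumes "0 < n" "j < Suc n" and pos: "\<And>i. 0 < a i"
  shows "0 < (real j * a (j - 1) + (real n - real j) * a j) / real n"
proof -
  have "0 < real j * a (j - 1) + (real n - real j) * a j"
  \<comment> \<open>The weight of \<open>a j\<close> is positive except at \<open>j = n\<close>,
    where the weight of \<open>a (j - 1)\<close> is \<open>n > 0\<close>.\<close>
  proof (cases "j = n")
    case True
    with assms show ?thesis by simp
  next
    case False
    with assms have "0 < (real n - real j) * a j"
      by (intro mult_pos_pos) auto
    moreover have "0 \<le> real j * a (j - 1)"
      using pos by (simp add: less_imp_le)
    ultimately show ?thesis by linarith
  qed
  then show ?thesis using assms(1) by simp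
qed

text \<open>The blocks of length \<open>n\<close> consisting of \<open>j\<close> copies of \<open>a (j - 1)\<close> and \<open>n - j\<close> copies of
  \<open>a j\<close>, for \<open>j \<le> n\<close>, together contain every \<open>a j\<close> with \<open>j < n\<close> exactly \<open>n + 1\<close> times. Rotating
  all blocks simultaneously gives \<open>n\<close> permutations of one tuple, whose average is constant on
  each block.\<close>

lemma mean_le_mean_interpolated:
  fixes a :: "nat \<Rightarrow> real"
  assumes M: "symmetric_mean M" "repetition_invariant M" "jensen_concave_mean M"
    and n: "0 < n" and pos: "\<And>i. 0 < a i"
  shows "M (map a [0..<n])
    \<le> M (map (\<lambda>j. (real j * a (j - 1) + (real n - real j) * a j) / real n) [0..<Suc n])"
proof -
  \<comment> \<open>\<open>y j\<close> is the unrotated block \<open>j\<close>, and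
    \<open>z t\<close> concatenates all blocks, each rotated by \<open>t\<close>. The truncated
    index \<open>j - 1\<close> at \<open>j = 0\<close> and the entry \<open>a n\<close> at
    \<open>j = n\<close> never occur, since \<open>s < n\<close>.\<close>
  define y where "y j s = (if s < j then a (j - 1) else a j)" for j s :: nat
  define z where "z t p = y (p div n) ((p mod n + t) mod n)" for t p :: nat
  let ?b = "\<lambda>j. (real j * a (j - 1) + (real n - real j) * a j) / real n"
  let ?L = "Suc n * n"
  have ypos: "0 < y j s" for j s by (simp add: y_def pos)
  have bpos: "0 < ?b j" if "j < Suc n" for j
    using n that pos by (rule interpolation_pos)
  have block: "(\<Sum>s<n. f (y j s)) = (\<Sum>s<j. f (a (j - 1))) + (\<Sum>s<n - j. f (a j))"
    if "j < Suc n" for j and f :: "real \<Rightarrow> 'b::comm_monoid_add"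
  proof -
    have "(\<Sum>s<n. f (y j s)) = (\<Sum>s<j. f (y j s)) + (\<Sum>s=j..<n. f (y j s))"
      using that sum.atLeastLessThan_concat[of 0 j n "\<lambda>s. f (y j s)"] by (simp add: atLeast0LessThan)
    also have "(\<Sum>s=j..<n. f (y j s)) = (\<Sum>s<n - j. f (y j (s + j)))"
      using that sum.shift_bounds_nat_ivl[of "\<lambda>s. f (y j s)" 0 j "n - j"] by (simp add: atLeast0LessThan)
    finally show ?thesis by (simp add: y_def)
  qed
  \<comment> \<open>At a fixed position, the \<open>n\<close> rotations run through each entry of
    the block exactly once.\<close>
  have rot: "(\<Sum>t<n. z t p) / real n = ?b (p div n)" if "p < ?L" for p
  proof -
    have j: "p div n < Suc n" using that n by (simp add: less_mult_imp_div_less)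
    have "(\<Sum>t<n. z t p) = (\<Sum>t<n. y (p div n) t)"
      unfolding z_def using sum_rotate[OF n, of "y (p div n)" "p mod n"] by (simp add: add.commute)
    also have "\<dots> = real n * ?b (p div n)"
      using block[OF j, of "\<lambda>x. x"] j n by (simp add: of_nat_diff)
    finally show ?thesis using n by simp
  qed
  have perm: "M (map (z t) [0..<?L]) = M (map a [0..<n])" for t
  proof -
    have "mset (map (z t) [0..<?L]) = (\<Sum>j<Suc n. \<Sum>s<n. {#y j ((s + t) mod n)#})"
      unfolding mset_map_upt_blocks z_def by (intro sum.cong) auto
    also have "\<dots> = (\<Sum>j<Suc n. \<Sum>s<n. {#y j s#})"
      using n by (simp add: sum_rotate[OF n, of "\<lambda>s. {#y j s#}" for j])
    also have "\<dots> = (\<Sum>j<Suc n. replicate_mset j (a (j - 1)) + replicate_mset (n - j) (a j))"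
      by (intro sum.cong refl) (simp add: block[of _ "\<lambda>x. {#x#}"] sum_mset_singleton_const)
    also have "\<dots> = (\<Sum>j<Suc n. replicate_mset j (a (j - 1))) + (\<Sum>j<Suc n. replicate_mset (n - j) (a j))"
      by (rule sum.distrib)
    \<comment> \<open>Regrouping by value: \<open>a j\<close> occurs \<open>j + 1\<close> times in
      block \<open>j + 1\<close> and \<open>n - j\<close> times in block \<open>j\<close>. Block
      \<open>0\<close> drops out of the first sum, block \<open>n\<close> out of the second.\<close>
    also have "(\<Sum>j<Suc n. replicate_mset j (a (j - 1))) = (\<Sum>j<n. replicate_mset (Suc j) (a j))"
      by (subst sum.lessThan_Suc_shift) simp
    also have "(\<Sum>j<Suc n. replicate_mset (n - j) (a j)) = (\<Sum>j<n. replicate_mset (n - j) (a j))"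
      by simp
    also have "(\<Sum>j<n. replicate_mset (Suc j) (a j)) + (\<Sum>j<n. replicate_mset (n - j) (a j))
        = (\<Sum>j<n. replicate_mset (Suc j + (n - j)) (a j))"
      by (simp only: sum.distrib[symmetric] repeat_mset_distrib flip: repeat_mset_replicate_mset)
    also have "\<dots> = (\<Sum>j<n. \<Sum>s<Suc n. {#a ((j * Suc n + s) div Suc n)#})"
    proof (intro sum.cong refl)
      fix j assume "j \<in> {..<n}"
      then have 1: "Suc j + (n - j) = card {..<Suc n}" by simp
      have 2: "(j * Suc n + s) div Suc n = j" if "s \<in> {..<Suc n}" for s
        using that by (intro div_nat_eqI) auto
      show "replicate_mset (Suc j + (n - j)) (a j) = (\<Sum>s<Suc n. {#a ((j * Suc n + s) div Suc n)#})"
        unfolding 1 sum_mset_singleton_const[symmetric] by (intro sum.cong refl) (simp only: 2)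
    qed
    also have "\<dots> = mset (map (\<lambda>p. a (p div Suc n)) [0..<n * Suc n])"
      unfolding mset_map_upt_blocks ..
    finally have eq: "mset (map (z t) [0..<?L]) = mset (map (\<lambda>p. a (p div Suc n)) [0..<n * Suc n])" .
    have "map (\<lambda>p. a (p div Suc n)) [0..<n * Suc n] \<in> pos_tuples"
      unfolding pos_tuples_map_iff using n pos by auto
    with eq M(1) have "M (map (z t) [0..<?L]) = M (map (\<lambda>p. a (p div Suc n)) [0..<n * Suc n])"
      unfolding symmetric_mean_def by blast
    also have "\<dots> = M (map a [0..<n])"
      using n pos by (intro repetition_invariant_div M) auto
    finally show ?thesis .
  qed
  have "(\<Sum>t<n. M (map (z t) [0..<?L])) \<le> real n * M (map (\<lambda>p. (\<Sum>t<n. z t p) / real n) [0..<?L])"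
    using n ypos by (intro jensen_concave_mean_average M) (auto simp: z_def)
  also have "map (\<lambda>p. (\<Sum>t<n. z t p) / real n) [0..<?L] = map (\<lambda>p. ?b (p div n)) [0..<?L]"
    by (intro map_cong refl rot) simp
  also have "M \<dots> = M (map ?b [0..<Suc n])"
    using n bpos by (intro repetition_invariant_div M) auto
  finally show ?thesis
    unfolding perm using n by simp
qed

text \<open>With \<open>A j\<close> the average of the first \<open>j + 1\<close> terms and \<open>B j\<close> the interpolation of \<open>A (j - 1)\<close>
  and \<open>A j\<close> as above, \<open>(n + 1) A j = n B j + x j\<close> for all \<open>j \<le> n\<close>.\<close>

lemma kedlaya_inequality:
  fixes x :: "nat \<Rightarrow> real"
  assumes M: "symmetric_mean M" "repetition_invariant M" "jensen_concave_mean M"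
    and pos: "\<And>i. 0 < x i"
  shows "(\<Sum>k<n. M (map x [0..<Suc k])) \<le> real n * M (map (\<lambda>j. (\<Sum>i\<le>j. x i) / real (Suc j)) [0..<n])"
proof (induction n)
  case 0
  then show ?case by simp
next
  case (Suc n)
  let ?A = "\<lambda>j. (\<Sum>i\<le>j. x i) / real (Suc j)"
  let ?B = "\<lambda>j. (real j * ?A (j - 1) + (real n - real j) * ?A j) / real n"
  have Apos: "0 < ?A j" for j
    using pos by (intro divide_pos_pos sum_pos) auto
  show ?case
  proof (cases "n = 0")
    case True
    then show ?thesis by simp
  next
    case False
    \<comment> \<open>\<open>n\<close> copies of \<open>?B\<close> and one copy of \<open>x\<close>:
      the \<open>n + 1\<close> tuples whose average is \<open>?A\<close>.\<close>
    let ?v = "\<lambda>i. if i < n then ?B else x"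
    have Bpos: "0 < ?B j" if "j < Suc n" for j
      using False that Apos by (intro interpolation_pos) auto
    have avg: "(\<Sum>i<Suc n. ?v i j) / real (Suc n) = ?A j" for j
    proof -
      have "(\<Sum>i<Suc n. ?v i j) = real n * ?B j + x j" by simp
      also have "real n * ?B j = real j * ?A (j - 1) + (real n - real j) * ?A j"
        using False by simp
      \<comment> \<open>Both sides are the sum of the terms before \<open>x j\<close>; at
        \<open>j = 0\<close> both vanish.\<close>
      also have "real j * ?A (j - 1) = real (Suc j) * ?A j - x j"
        by (cases j) auto
      finally have "(\<Sum>i<Suc n. ?v i j) = real (Suc n) * ?A j"
        by (simp only: of_nat_Suc ring_distribs mult_1_left)
      then show ?thesis by simp
    qed
    have "(\<Sum>i<Suc n. M (map (?v i) [0..<Suc n]))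
        \<le> real (Suc n) * M (map (\<lambda>j. (\<Sum>i<Suc n. ?v i j) / real (Suc n)) [0..<Suc n])"
      using Bpos pos by (intro jensen_concave_mean_average M) auto
    then have "real n * M (map ?B [0..<Suc n]) + M (map x [0..<Suc n])
        \<le> real (Suc n) * M (map ?A [0..<Suc n])"
      unfolding avg by simp
    \<comment> \<open>This lengthens the tuple in the induction hypothesis from \<open>n\<close> to
      \<open>n + 1\<close> entries.\<close>
    moreover have "M (map ?A [0..<n]) \<le> M (map ?B [0..<Suc n])"
      using False Apos by (intro mean_le_mean_interpolated M) auto
    then have "real n * M (map ?A [0..<n]) \<le> real n * M (map ?B [0..<Suc n])"
      by (rule mult_left_mono) simp
    ultimately show ?thesis using Suc.IH by simp
  qed
qed

section \<open>Upper bound for the Hardy constant\<close>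

lemma sum_mean_le_harmonic_mean:
  fixes x :: "nat \<Rightarrow> real"
  assumes M: "increasing_mean M" "symmetric_mean M" "repetition_invariant M" "jensen_concave_mean M"
    and x: "\<And>i. 0 < x i" "summable x"
  shows "(\<Sum>k<n. M (map x [0..<Suc k])) \<le> real n * M (map (\<lambda>k. suminf x / real k) [1..<Suc n])"
proof (cases "n = 0")
  case False
  have "M (map (\<lambda>j. (\<Sum>i\<le>j. x i) / real (Suc j)) [0..<n]) \<le> M (map (\<lambda>j. suminf x / real (Suc j)) [0..<n])"
  proof (intro increasing_mean_mono M)
    fix j
    show "0 < (\<Sum>i\<le>j. x i) / real (Suc j)"
      using x by (intro divide_pos_pos sum_pos) auto
    have "(\<Sum>i\<le>j. x i) \<le> suminf x"
      using x by (intro sum_le_suminf) (auto intro: less_imp_le)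
    then show "(\<Sum>i\<le>j. x i) / real (Suc j) \<le> suminf x / real (Suc j)"
      by (rule divide_right_mono) simp
  qed (use False in auto)
  also have "map (\<lambda>j. suminf x / real (Suc j)) [0..<n] = map (\<lambda>k. suminf x / real k) [1..<Suc n]"
    by (intro nth_equalityI) (auto simp del: upt_Suc)
  finally have "real n * M (map (\<lambda>j. (\<Sum>i\<le>j. x i) / real (Suc j)) [0..<n])
      \<le> real n * M (map (\<lambda>k. suminf x / real k) [1..<Suc n])"
    by (rule mult_left_mono) simp
  moreover have "(\<Sum>k<n. M (map x [0..<Suc k]))
      \<le> real n * M (map (\<lambda>j. (\<Sum>i\<le>j. x i) / real (Suc j)) [0..<n])"
    using x(1) by (intro kedlaya_inequality M) auto
  ultimately show ?thesis by linarith
qed simp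

text \<open>For a given \<open>x\<close> only the scale \<open>y = suminf x\<close> matters; the
  supremum over \<open>y\<close> makes the constant independent of \<open>x\<close>.\<close>

lemma hardy_bound_SUP_liminf:
  assumes M: "is_mean M" "increasing_mean M" "symmetric_mean M" "repetition_invariant M"
    "jensen_concave_mean M"
  shows "hardy_bound M (SUP y\<in>{0::real<..}. liminf (\<lambda>n::nat.
        ereal (real n / y * M (map (\<lambda>k. y / real k) [1..<Suc n]))))" (is "hardy_bound M ?C")
proof -
  let ?g = "\<lambda>y n. real n / y * M (map (\<lambda>k. y / real k) [1..<Suc n])"
  have gpos: "0 \<le> ?g y n" if "0 < y" for y n
  proof (cases "n = 0")
    case False
    then have "map (\<lambda>k. y / real k) [1..<Suc n] \<in> pos_tuples"
      using that by (auto simp: pos_tuples_def)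
    then show ?thesis using is_mean_pos[OF M(1)] that by (simp add: less_imp_le)
  qed simp
  have "0 \<le> liminf (\<lambda>n. ereal (?g 1 n))"
    using gpos[of 1] by (intro Liminf_bounded always_eventually) (auto simp del: upt_Suc)
  also have "\<dots> \<le> ?C" by (rule SUP_upper) simp
  finally have "0 \<le> ?C" .
  moreover have "(\<Sum>n. ereal (M (map x [0..<Suc n]))) \<le> ?C * ereal (\<Sum>n. x n)"
    if x: "\<forall>n. 0 < x n" "summable x" for x
  proof (intro suminf_bound allI)
    let ?y = "suminf x"
    have y: "0 < ?y" using x by (simp add: suminf_pos)
    have Mpos: "0 < M (map x [0..<Suc k])" for k
      using x by (intro is_mean_pos[OF M(1)]) (auto simp: pos_tuples_map_iff simp del: upt_Suc)
    show "0 \<le> ereal (M (map x [0..<Suc k]))" for k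
      using Mpos[of k] by (simp del: upt_Suc)
    fix n
    let ?S = "\<lambda>n. \<Sum>k<n. M (map x [0..<Suc k])"
    \<comment> \<open>The means are positive, so a fixed partial sum stays below the bounds for all
      later \<open>m\<close>, hence below their lower limit.\<close>
    have "?S n / ?y \<le> ?g ?y m" if "n \<le> m" for m
    proof -
      have "?S n \<le> ?S m"
        using that Mpos by (intro sum_mono2) (auto intro: less_imp_le simp del: upt_Suc)
      also have "\<dots> \<le> real m * M (map (\<lambda>k. ?y / real k) [1..<Suc m])"
        using x by (intro sum_mean_le_harmonic_mean M) auto
      finally show ?thesis using y by (simp add: field_simps del: upt_Suc)
    qed
    then have "ereal (?S n / ?y) \<le> liminf (\<lambda>m. ereal (?g ?y m))"
      by (intro Liminf_bounded) (auto simp: eventually_sequentially simp del: upt_Suc)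
    also have "\<dots> \<le> ?C" using y by (intro SUP_upper) simp
    finally have "ereal (?S n / ?y) * ereal ?y \<le> ?C * ereal ?y"
      using y by (intro ereal_mult_right_mono) auto
    then show "(\<Sum>k<n. ereal (M (map x [0..<Suc k]))) \<le> ?C * ereal ?y"
      using y by (simp del: upt_Suc)
  qed
  ultimately show ?thesis unfolding hardy_bound_def by blast
qed

section \<open>Lower bound for the Hardy constant\<close>

text \<open>The harmonic sequence with scale \<open>y\<close> is not summable, so it is cut off after \<open>m\<close> terms and
  continued geometrically; the divergence of the harmonic series absorbs all bounded errors.\<close>

lemma liminf_le_hardy_bound:
  assumes M: "is_mean M" and C: "hardy_bound M C" and y: "0 < y"
  shows "liminf (\<lambda>n. ereal (real n / y * M (map (\<lambda>k. y / real k) [1..<Suc n]))) \<le> C"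
proof (rule ccontr)
  let ?g = "\<lambda>n. real n / y * M (map (\<lambda>k. y / real k) [1..<Suc n])"
  assume "\<not> ?thesis"
  then have less: "C < liminf (\<lambda>n. ereal (?g n))" by simp
  moreover have "0 \<le> C" using C by (simp add: hardy_bound_def)
  \<comment> \<open>\<open>C\<close> lies strictly below a lower limit and is nonnegative, hence
    finite.\<close>
  ultimately obtain h where h: "C = ereal h" "0 \<le> h" by (cases C) auto
  obtain c where c: "ereal h < ereal c" "ereal c < liminf (\<lambda>n. ereal (?g n))"
    using less ereal_dense2 unfolding h by blast
  have "eventually (\<lambda>n. ereal c < ereal (?g n)) sequentially"
    by (rule less_LiminfD[OF c(2)])
  then obtain N where N: "\<And>n. N \<le> n \<Longrightarrow> c < ?g n"
    by (auto simp: eventually_sequentially simp del: upt_Suc)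
  \<comment> \<open>As \<open>m\<close> grows, the left side is unbounded because
    \<open>c > h\<close>, while the right side is fixed.\<close>
  have bound: "(c - h) * harm m \<le> c * harm N + h" if m: "N \<le> m" for m
  proof -
    define x where "x k = (if k < m then y / real (Suc k) else y * (1 / 2) ^ Suc k)" for k
    have xpos: "0 < x k" for k using y by (simp add: x_def)
    let ?e = "\<lambda>k. if k < m then y / real (Suc k) else 0"
    have geo: "(\<lambda>k. y * (1 / 2) ^ Suc k) sums y"
      using sums_mult[OF power_half_series, of y] by simp
    have fin: "?e sums (y * harm m)"
    proof -
      have "?e sums (\<Sum>k<m. y / real (Suc k))"
        using sums_If_finite_set[of "{..<m}" "\<lambda>k. y / real (Suc k)"] by simp
      also have "(\<Sum>k<m. y / real (Suc k)) = y * harm m"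
        by (simp add: harm_altdef sum_distrib_left divide_inverse)
      finally show ?thesis .
    qed
    have sum: "(\<lambda>k. ?e k + y * (1 / 2) ^ Suc k) sums (y * harm m + y)"
      by (rule sums_add[OF fin geo])
    \<comment> \<open>The full geometric series, of sum \<open>y\<close>, covers the tail, so
      truncation costs at most an extra \<open>y\<close> in the sum of \<open>x\<close>.\<close>
    have le: "x k \<le> ?e k + y * (1 / 2) ^ Suc k" for k
      using y by (simp add: x_def)
    have summ: "summable x"
      using xpos le by (intro summable_comparison_test'[OF sums_summable[OF sum], of 0]) (auto simp: less_imp_le)
    have suminf: "suminf x \<le> y * harm m + y"
      using suminf_le[OF le summ sums_summable[OF sum]] sums_unique[OF sum] by simp
    have Mpos: "0 < M (map x [0..<Suc k])" for k
      using xpos by (intro is_mean_pos[OF M]) (auto simp: pos_tuples_map_iff simp del: upt_Suc)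
    \<comment> \<open>Before the cut-off the prefix of \<open>x\<close> is exactly the harmonic
      tuple, so the choice of \<open>N\<close> applies.\<close>
    have Mx: "c * y / real (Suc k) \<le> M (map x [0..<Suc k])" if "k \<in> {N..<m}" for k
    proof -
      have "map x [0..<Suc k] = map (\<lambda>k. y / real k) [1..<Suc (Suc k)]"
        using that by (intro nth_equalityI) (auto simp: x_def simp del: upt_Suc)
      moreover have "c < ?g (Suc k)" using that by (intro N) auto
      ultimately show ?thesis using y by (simp add: field_simps del: upt_Suc)
    qed
    \<comment> \<open>Only the indices from \<open>N\<close> to \<open>m - 1\<close> are estimated
      from below; all other means are dropped by positivity.\<close>
    have "c * y * (harm m - harm N) = (\<Sum>k=N..<m. c * y / real (Suc k))"
    proof -
      have "(\<Sum>k<N. inverse (real (Suc k))) + (\<Sum>k=N..<m. inverse (real (Suc k))) = (\<Sum>k<m. inverse (real (Suc k)))"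
        using m sum.atLeastLessThan_concat[of 0 N m "\<lambda>k. inverse (real (Suc k))"] by (simp only: atLeast0LessThan)
      then have "harm m - harm N = (\<Sum>k=N..<m. inverse (real (Suc k)))"
        by (simp add: harm_altdef)
      then show ?thesis by (simp add: sum_distrib_left divide_inverse)
    qed
    also have "\<dots> \<le> (\<Sum>k=N..<m. M (map x [0..<Suc k]))"
      by (rule sum_mono[OF Mx])
    also have "\<dots> \<le> (\<Sum>k<m. M (map x [0..<Suc k]))"
      using Mpos by (intro sum_mono2) (auto intro: less_imp_le simp del: upt_Suc)
    also have "\<dots> \<le> h * suminf x"
    proof -
      have "(\<Sum>k<m. ereal (M (map x [0..<Suc k]))) \<le> (\<Sum>k. ereal (M (map x [0..<Suc k])))"
        using Mpos by (intro sum_le_suminf summable_ereal_pos) (auto intro: less_imp_le simp del: upt_Suc)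
      also have "\<dots> \<le> C * ereal (suminf x)"
        using C xpos summ unfolding hardy_bound_def by blast
      finally show ?thesis unfolding h by (simp del: upt_Suc)
    qed
    also have "\<dots> \<le> h * (y * harm m + y)"
      using suminf h by (intro mult_left_mono)
    finally have "y * ((c - h) * harm m) \<le> y * (c * harm N + h)"
      by (simp add: algebra_simps)
    then show ?thesis using y by simp
  qed
  have "filterlim (\<lambda>m. harm m :: real) at_top sequentially"
    by (rule harm_at_top)
  then have "eventually (\<lambda>m. (c * harm N + h) / (c - h) < harm m) sequentially"
    by (simp add: filterlim_at_top_dense)
  then obtain m where m: "N \<le> m" "(c * harm N + h) / (c - h) < harm m"
    by (metis (mono_tags, lifting) eventually_sequentially nat_le_linear)
  with c bound[OF m(1)] show False by (simp add: field_simps)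
qed

theorem theorem3p4:
  fixes M :: "real list \<Rightarrow> real"
  assumes "is_mean M"
    and "increasing_mean M"
    and "symmetric_mean M"
    and "repetition_invariant M"
    and "jensen_concave_mean M"
  shows "hardy_constant M =
    (SUP y\<in>{0::real<..}. liminf (\<lambda>n::nat.
        ereal (real n / y * M (map (\<lambda>k. y / real k) [1..<Suc n]))))"
proof (rule antisym)
  show "hardy_constant M \<le> (SUP y\<in>{0::real<..}. liminf (\<lambda>n::nat.
        ereal (real n / y * M (map (\<lambda>k. y / real k) [1..<Suc n]))))"
    by (intro hardy_constant_least(2) hardy_bound_SUP_liminf assms)
  show "(SUP y\<in>{0::real<..}. liminf (\<lambda>n::nat.
        ereal (real n / y * M (map (\<lambda>k. y / real k) [1..<Suc n])))) \<le> hardy_constant M"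
    by (intro SUP_least liminf_le_hardy_bound hardy_constant_least(1) assms) simp
qed

end
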